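(* There exists a universal constant $C_0>0$ such that for all real $\epsilon_1$ with $|\epsilon_1|<1/2$, $$\sup_{\lambda\in\mathbb{R}}\left|\int_{\mathbb{R}}e^{i|t|^{\epsilon_1}}e^{-i\lambda t}\frac{dt}{t}\right|\le C_0,$$ and for all real $\epsilon_2$ with $1/2<\epsilon_2<3/2$, $$\sup_{\lambda\in\mathbb{R}}\left|\int_{\mathbb{R}}e^{i\,\mathrm{sgn}(t)|t|^{\epsilon_2}}e^{-i\lambda t}\frac{dt}{t}\right|\le C_0.$$
   Context: The integrals are understood in the symmetric principal value sense, i.e. as $\lim_{r\to0^+,\,R\to\infty}\int_{r<|t|<R}$. *)

theory Defs
  imports "HOL-Analysis.Analysis"
begin

definition truncated_integral :: "(real \<Rightarrow> complex) \<Rightarrow> real \<Rightarrow> real \<Rightarrow> complex" where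
  "truncated_integral f r R = (LINT t:{t. r < \<bar>t\<bar> \<and> \<bar>t\<bar> < R}|lborel. f t)"

text \<open>Symmetric principal value over the real line. The double limit
  \<open>r \<rightarrow> 0+\<close>, \<open>R \<rightarrow> \<infinity>\<close> is a joint one: \<open>r\<close> and \<open>R\<close> vary independently, which is
  expressed by the product filter.\<close>

definition has_pv_integral :: "(real \<Rightarrow> complex) \<Rightarrow> complex \<Rightarrow> bool" where
  "has_pv_integral f I \<longleftrightarrow>
     ((\<lambda>(r, R). truncated_integral f r R) \<longlongrightarrow> I) (at_right 0 \<times>\<^sub>F at_top)"

definition pv_convergent :: "(real \<Rightarrow> complex) \<Rightarrow> bool" where
  "pv_convergent f \<longleftrightarrow> (\<exists>I. has_pv_integral f I)"

definition pv_integral :: "(real \<Rightarrow> complex) \<Rightarrow> complex" where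
  "pv_integral f = (THE I. has_pv_integral f I)"

definition even_phase_integrand :: "real \<Rightarrow> real \<Rightarrow> real \<Rightarrow> complex" where
  "even_phase_integrand \<epsilon> l t =
     exp (\<i> * of_real (\<bar>t\<bar> powr \<epsilon>)) * exp (- \<i> * of_real (l * t)) / of_real t"

definition odd_phase_integrand :: "real \<Rightarrow> real \<Rightarrow> real \<Rightarrow> complex" where
  "odd_phase_integrand \<epsilon> l t =
     exp (\<i> * of_real (sgn t * \<bar>t\<bar> powr \<epsilon>)) * exp (- \<i> * of_real (l * t)) / of_real t"

end

theory Submission
  imports Defs
begin

text \<open>
  Folding \<open>t\<close> with \<open>-t\<close> and substituting \<open>t = exp x\<close> turns the integrals into
  \<open>2 \<i> \<integral> sin (exp (\<epsilon> x) - \<lambda> exp x) dx\<close> in the odd case and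
  \<open>-2 \<i> \<integral> cis (exp (\<epsilon> x)) sin (\<lambda> exp x) dx\<close> in the even case. All phases have the form
  \<open>p x = \<alpha> exp x + \<beta> exp (\<epsilon> x)\<close>, whose derivatives have the same form and so change sign at most
  once; hence the first derivative test of van der Corput applies without further conditions
  wherever \<open>\<bar>p'\<bar>\<close> is bounded below.

  In the even case \<open>x < - ln \<bar>\<lambda>\<bar>\<close> is trivial, and to the right of that point \<open>\<bar>p'\<bar> \<ge> 1/2\<close> outside an
  interval of length 4 around the zero of \<open>p'\<close>, because \<open>\<epsilon> - 1\<close> stays away from 0.
  In the odd case \<open>\<epsilon>\<close> may be close to 1 and the zero of \<open>p'\<close> is nearly degenerate. There
  \<open>\<bar>p\<bar> \<le> 5 \<bar>p'\<bar>\<close> at distance at least 1 from the zero, so that where \<open>\<bar>p'\<bar> \<le> 1\<close> one can integrate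
  \<open>\<bar>sin p\<bar> \<le> 5 \<bar>p'\<bar>\<close> exactly, however long the interval is.
\<close>

section \<open>Oscillatory integrals\<close>

text \<open>Zeros are allowed, so that two closed intervals meeting at a zero of \<open>f\<close>
  can both qualify.\<close>

definition sign_const_on :: "(real \<Rightarrow> real) \<Rightarrow> real set \<Rightarrow> bool" where
  "sign_const_on f S \<longleftrightarrow> (\<forall>x\<in>S. 0 \<le> f x) \<or> (\<forall>x\<in>S. f x \<le> 0)"

lemma sign_const_on_subset: "sign_const_on f T \<Longrightarrow> S \<subseteq> T \<Longrightarrow> sign_const_on f S"
  unfolding sign_const_on_def by blast

text \<open>Integration by parts against \<open>cis p / p'\<close>. Since \<open>p''\<close> keeps
  its sign, \<open>1 / p'\<close> is monotone and its total variation telescopes to endpoint values;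
  the boundary terms and the variation cost \<open>2 / m\<close> each.\<close>

lemma van_der_corput:
  fixes p p' p'' :: "real \<Rightarrow> real"
  assumes "a \<le> b" "0 < m"
    and p: "\<And>x. (p has_real_derivative p' x) (at x)"
    and p': "\<And>x. (p' has_real_derivative p'' x) (at x)"
    and m: "\<And>x. x \<in> {a..b} \<Longrightarrow> m \<le> \<bar>p' x\<bar>"
    and sgn: "sign_const_on p'' {a..b}"
  shows "norm (integral {a..b} (\<lambda>x. cis (p x))) \<le> 4 / m"
proof -
  have nz: "p' x \<noteq> 0" if "x \<in> {a..b}" for x
    using m[OF that] \<open>0 < m\<close> by auto
  obtain s :: real where s: "\<bar>s\<bar> = 1" "\<And>x. x \<in> {a..b} \<Longrightarrow> 0 \<le> s * p'' x"
  proof -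
    from sgn consider "\<forall>x\<in>{a..b}. 0 \<le> p'' x" | "\<forall>x\<in>{a..b}. p'' x \<le> 0"
      unfolding sign_const_on_def by blast
    then show ?thesis using that[of 1] that[of "-1"] by cases auto
  qed
  define V where "V x = (1 / p' x) *\<^sub>R (- \<i> * cis (p x))" for x
  define W where "W x = (p'' x / (p' x)\<^sup>2) *\<^sub>R (- \<i> * cis (p x))" for x
  \<comment> \<open>Product rule: \<open>cis p\<close> is the exact derivative of \<open>V\<close>
    plus the remainder \<open>W\<close>, which comes from differentiating
    \<open>1 / p'\<close>.\<close>
  have dV: "(V has_vector_derivative (cis (p x) - W x)) (at x within {a..b})"
    if "x \<in> {a..b}" for x
  proof -
    have 1: "((\<lambda>x. 1 / p' x) has_real_derivative (- p'' x / (p' x)\<^sup>2)) (at x within {a..b})"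
      using nz[OF that]
      by (auto intro!: derivative_eq_intros has_field_derivative_at_within[OF p'] simp: power2_eq_square)
    have "(p has_derivative (\<lambda>t. p' x * t)) (at x within {a..b})"
      using has_field_derivative_at_within[OF p] by (simp add: has_field_derivative_def)
    from has_derivative_cis[OF this]
    have 2: "((\<lambda>x. cis (p x)) has_vector_derivative (p' x *\<^sub>R (\<i> * cis (p x)))) (at x within {a..b})"
      by (simp add: has_vector_derivative_def mult_ac)
    have "((\<lambda>x. - \<i> * cis (p x)) has_vector_derivative - \<i> * (p' x *\<^sub>R (\<i> * cis (p x)))) (at x within {a..b})"
      by (intro has_vector_derivative_mult_right 2)
    from has_vector_derivative_scaleR[OF 1 this] show ?thesis
      using nz[OF that] unfolding V_def W_def by (simp add: algebra_simps)
  qed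
  have iV: "((\<lambda>x. cis (p x) - W x) has_integral (V b - V a)) {a..b}"
    using fundamental_theorem_of_calculus[OF \<open>a \<le> b\<close> dV] by simp
  have cp: "continuous_on {a..b} p"
    by (meson DERIV_isCont continuous_at_imp_continuous_on p)
  have ic: "(\<lambda>x. cis (p x)) integrable_on {a..b}"
    by (intro integrable_continuous_real continuous_intros cp)
  have iW: "W integrable_on {a..b}"
    using integrable_diff[OF ic has_integral_integrable[OF iV]] by simp
  \<comment> \<open>With \<open>s\<close> the sign of \<open>p''\<close>, this derivative is the
    norm of \<open>W\<close>, so the remainder is bounded by an explicitly computable
    integral.\<close>
  have dS: "((\<lambda>x. - s / p' x) has_vector_derivative (s * p'' x / (p' x)\<^sup>2)) (at x within {a..b})"
    if "x \<in> {a..b}" for x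
    using nz[OF that] unfolding has_real_derivative_iff_has_vector_derivative[symmetric]
    by (auto intro!: derivative_eq_intros has_field_derivative_at_within[OF p'] simp: power2_eq_square)
  have iS: "((\<lambda>x. s * p'' x / (p' x)\<^sup>2) has_integral (- s / p' b - - s / p' a)) {a..b}"
    using fundamental_theorem_of_calculus[OF \<open>a \<le> b\<close> dS] by simp
  have inv: "\<bar>1 / p' x\<bar> \<le> 1 / m" if "x \<in> {a..b}" for x
    using m[OF that] \<open>0 < m\<close> by (simp add: frac_le)
  have "norm (integral {a..b} W) \<le> integral {a..b} (\<lambda>x. s * p'' x / (p' x)\<^sup>2)"
  proof (rule integral_norm_bound_integral[OF iW has_integral_integrable[OF iS]])
    fix x assume x: "x \<in> {a..b}"
    have "norm (W x) = \<bar>p'' x\<bar> / (p' x)\<^sup>2"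
      unfolding W_def by (simp add: norm_mult)
    also have "\<bar>p'' x\<bar> = s * p'' x"
      using s(1) s(2)[OF x] by (metis abs_mult abs_of_nonneg mult_1)
    finally show "norm (W x) \<le> s * p'' x / (p' x)\<^sup>2" by simp
  qed
  also have "\<dots> = s * (1 / p' a) - s * (1 / p' b)"
    using integral_unique[OF iS] by simp
  also have "\<dots> \<le> \<bar>s * (1 / p' a)\<bar> + \<bar>s * (1 / p' b)\<bar>" by linarith
  also have "\<dots> \<le> 2 / m"
    using inv[of a] inv[of b] \<open>a \<le> b\<close> s(1) by (simp add: abs_mult)
  finally have "norm (integral {a..b} W) \<le> 2 / m" .
  moreover have "norm (V x) \<le> 1 / m" if "x \<in> {a..b}" for x
    using inv[OF that] unfolding V_def by (simp add: norm_mult)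
  then have "norm (V b - V a) \<le> 2 / m"
    using norm_triangle_ineq4[of "V b" "V a"] \<open>a \<le> b\<close>
    by (smt (verit) add_divide_distrib atLeastAtMost_iff)
  moreover have "integral {a..b} (\<lambda>x. cis (p x)) = (V b - V a) + integral {a..b} W"
    using integral_diff[OF ic iW] integral_unique[OF iV] by simp
  ultimately show ?thesis
    using norm_triangle_ineq[of "V b - V a" "integral {a..b} W"] by simp
qed

text \<open>Where \<open>\<bar>p'\<bar> \<ge> 1\<close> oscillation bounds the integral; where \<open>\<bar>p'\<bar> \<le> 1\<close> the integrand is dominated by
  \<open>C p'\<close>, whose integral is controlled by the (small) endpoint values of \<open>p\<close>.\<close>

lemma integral_sin_phase_bound_mono:
  fixes p p' p'' :: "real \<Rightarrow> real"
  assumes "a \<le> b" "0 \<le> C"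
    and p: "\<And>x. (p has_real_derivative p' x) (at x)"
    and p': "\<And>x. (p' has_real_derivative p'' x) (at x)"
    and nn: "\<And>x. x \<in> {a..b} \<Longrightarrow> 0 \<le> p' x"
    and C: "\<And>x. x \<in> {a..b} \<Longrightarrow> \<bar>p x\<bar> \<le> C * p' x"
    and sgn: "sign_const_on p'' {a..b}"
  shows "\<bar>integral {a..b} (\<lambda>x. sin (p x))\<bar> \<le> 4 + 2 * C\<^sup>2"
proof -
  have cp: "continuous_on A p" for A
    by (meson DERIV_isCont continuous_at_imp_continuous_on p)
  have int: "(\<lambda>x. sin (p x)) integrable_on {u..v}" for u v
    by (intro integrable_continuous_real continuous_intros cp)
  have mono: "(\<forall>x y. a \<le> x \<longrightarrow> x \<le> y \<longrightarrow> y \<le> b \<longrightarrow> p' x \<le> p' y) \<or>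
              (\<forall>x y. a \<le> x \<longrightarrow> x \<le> y \<longrightarrow> y \<le> b \<longrightarrow> p' y \<le> p' x)"
  proof -
    from sgn consider "\<forall>x\<in>{a..b}. 0 \<le> p'' x" | "\<forall>x\<in>{a..b}. p'' x \<le> 0"
      unfolding sign_const_on_def by blast
    then show ?thesis
    proof cases
      case 1
      then have "p' x \<le> p' y" if "a \<le> x" "x \<le> y" "y \<le> b" for x y
        using that p' by (intro DERIV_nonneg_imp_nondecreasing[of x y p']) fastforce+
      then show ?thesis by blast
    next
      case 2
      then have "p' y \<le> p' x" if "a \<le> x" "x \<le> y" "y \<le> b" for x y
        using that p' by (intro DERIV_nonpos_imp_nonincreasing[of x y p']) fastforce+
      then show ?thesis by blast
    qed
  qed
  have small: "\<bar>integral {u..v} (\<lambda>x. sin (p x))\<bar> \<le> 2 * C\<^sup>2"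
    if "a \<le> u" "u \<le> v" "v \<le> b" "p' u \<le> 1" "p' v \<le> 1" for u v
  proof -
    have i: "((\<lambda>x. C * p' x) has_integral (C * p v - C * p u)) {u..v}"
      by (intro fundamental_theorem_of_calculus that)
        (auto intro!: derivative_eq_intros has_field_derivative_at_within[OF p]
          simp: has_real_derivative_iff_has_vector_derivative[symmetric])
    have "norm (integral {u..v} (\<lambda>x. sin (p x))) \<le> integral {u..v} (\<lambda>x. C * p' x)"
    proof (rule integral_norm_bound_integral[OF int has_integral_integrable[OF i]])
      fix x assume "x \<in> {u..v}"
      then have "\<bar>p x\<bar> \<le> C * p' x" using C that by auto
      then show "norm (sin (p x)) \<le> C * p' x"
        using abs_sin_x_le_abs_x[of "p x"] by simp
    qed
    also have "\<dots> = C * (p v - p u)"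
      using integral_unique[OF i] by (simp add: algebra_simps)
    \<comment> \<open>At both endpoints \<open>p' \<le> 1\<close>, hence
      \<open>\<bar>p\<bar> \<le> C\<close> there.\<close>
    also have "\<dots> \<le> C * (2 * C)"
    proof (rule mult_left_mono[OF _ \<open>0 \<le> C\<close>])
      have "\<bar>p u\<bar> \<le> C" "\<bar>p v\<bar> \<le> C"
        using C[of u] C[of v] that mult_left_mono[OF that(4) \<open>0 \<le> C\<close>] mult_left_mono[OF that(5) \<open>0 \<le> C\<close>]
        by auto
      then show "p v - p u \<le> 2 * C" by linarith
    qed
    finally show ?thesis by (simp add: power2_eq_square)
  qed
  have large: "\<bar>integral {u..v} (\<lambda>x. sin (p x))\<bar> \<le> 4"
    if "a \<le> u" "u \<le> v" "v \<le> b" "p' u \<ge> 1" "p' v \<ge> 1" for u v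
  proof -
    \<comment> \<open>Monotonicity of \<open>p'\<close> carries the lower bound from the endpoints
      to the whole interval.\<close>
    have "1 \<le> p' x" if "x \<in> {u..v}" for x
      using mono \<open>a \<le> u\<close> \<open>u \<le> v\<close> \<open>v \<le> b\<close> \<open>p' u \<ge> 1\<close> \<open>p' v \<ge> 1\<close> that
      by (meson atLeastAtMost_iff order_trans)
    moreover have "sign_const_on p'' {u..v}"
      using sgn that by (elim sign_const_on_subset) auto
    ultimately have "norm (integral {u..v} (\<lambda>x. cis (p x))) \<le> 4 / 1"
      using p p' that by (intro van_der_corput) (auto intro: order_trans[OF _ abs_ge_self])
    moreover have "integral {u..v} (\<lambda>x. sin (p x)) = Im (integral {u..v} (\<lambda>x. cis (p x)))"
    proof -
      have "(\<lambda>x. cis (p x)) integrable_on {u..v}"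
        by (intro integrable_continuous_real continuous_intros cp)
      from integral_linear[OF this bounded_linear_Im] show ?thesis by (simp add: o_def)
    qed
    ultimately show ?thesis
      using abs_Im_le_cmod[of "integral {u..v} (\<lambda>x. cis (p x))"] by simp
  qed
  have cp': "continuous_on A p'" for A
    by (meson DERIV_isCont continuous_at_imp_continuous_on p')
  have split: "\<bar>integral {a..b} (\<lambda>x. sin (p x))\<bar> \<le>
      \<bar>integral {a..c} (\<lambda>x. sin (p x))\<bar> + \<bar>integral {c..b} (\<lambda>x. sin (p x))\<bar>"
    if "a \<le> c" "c \<le> b" for c
    using Henstock_Kurzweil_Integration.integral_combine[OF that int] by linarith
  have C2: "0 \<le> C\<^sup>2" by simp
  \<comment> \<open>A cut where \<open>p'\<close> equals 1 leaves one piece of each kind, and the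
    two bounds add up to \<open>4 + 2 * C\<^sup>2\<close>.\<close>
  consider "p' a \<le> 1" "p' b \<le> 1" | "p' a \<ge> 1" "p' b \<ge> 1"
    | "p' a \<le> 1" "p' b \<ge> 1" | "p' a \<ge> 1" "p' b \<le> 1" by linarith
  then show ?thesis
  proof cases
    case 1
    then show ?thesis using small[of a b] \<open>a \<le> b\<close> by simp
  next
    case 2
    then show ?thesis using large[of a b] \<open>a \<le> b\<close> C2 by linarith
  next
    case 3
    then obtain c where "a \<le> c" "c \<le> b" "p' c = 1"
      using IVT'[of p' a 1 b] cp' \<open>a \<le> b\<close> by auto
    then show ?thesis using small[of a c] large[of c b] 3 split[of c] by auto
  next
    case 4
    then obtain c where "a \<le> c" "c \<le> b" "p' c = 1"
      using IVT2'[of p' b 1 a] cp' \<open>a \<le> b\<close> by auto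
    then show ?thesis using large[of a c] small[of c b] 4 split[of c] by auto
  qed
qed

text \<open>Sine is odd, so replacing \<open>p\<close> by \<open>- p\<close> reduces a nonpositive
  derivative to a nonnegative one.\<close>

lemma integral_sin_phase_bound:
  fixes p p' p'' :: "real \<Rightarrow> real"
  assumes "a \<le> b" "0 \<le> C"
    and p: "\<And>x. (p has_real_derivative p' x) (at x)"
    and p': "\<And>x. (p' has_real_derivative p'' x) (at x)"
    and C: "\<And>x. x \<in> {a..b} \<Longrightarrow> \<bar>p x\<bar> \<le> C * \<bar>p' x\<bar>"
    and sgn': "sign_const_on p' {a..b}"
    and sgn: "sign_const_on p'' {a..b}"
  shows "\<bar>integral {a..b} (\<lambda>x. sin (p x))\<bar> \<le> 4 + 2 * C\<^sup>2"
proof -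
  from sgn' consider "\<forall>x\<in>{a..b}. 0 \<le> p' x" | "\<forall>x\<in>{a..b}. p' x \<le> 0"
    unfolding sign_const_on_def by blast
  then show ?thesis
  proof cases
    case 1
    then show ?thesis
      using C by (intro integral_sin_phase_bound_mono[OF assms(1,2) p p' _ _ sgn]) auto
  next
    case 2
    have "\<bar>integral {a..b} (\<lambda>x. sin (- p x))\<bar> \<le> 4 + 2 * C\<^sup>2"
    proof (rule integral_sin_phase_bound_mono[where p' = "\<lambda>x. - p' x" and p'' = "\<lambda>x. - p'' x"])
      show "sign_const_on (\<lambda>x. - p'' x) {a..b}"
        using sgn unfolding sign_const_on_def by auto
      show "\<bar>- p x\<bar> \<le> C * - p' x" if "x \<in> {a..b}" for x
        using C[OF that] 2 that by simp
    qed (use assms 2 in \<open>auto intro!: derivative_intros\<close>)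
    then show ?thesis by simp
  qed
qed

section \<open>Bounds uniform over subintervals\<close>

text \<open>Uniformity over all compact subintervals serves two purposes: on the whole line it
  bounds the limit, on a tail it is a Cauchy condition. The clause \<open>0 \<le> M\<close> covers
  an empty \<open>S\<close>, which a cut can leave on one side, so that bounds may still be
  added.\<close>

definition integral_bdd_on :: "(real \<Rightarrow> 'a::euclidean_space) \<Rightarrow> real set \<Rightarrow> real \<Rightarrow> bool" where
  "integral_bdd_on f S M \<longleftrightarrow>
     0 \<le> M \<and> (\<forall>a b. a \<le> b \<longrightarrow> {a..b} \<subseteq> S \<longrightarrow> norm (integral {a..b} f) \<le> M)"

lemma integral_bdd_onI:
  "0 \<le> M \<Longrightarrow> (\<And>a b. a \<le> b \<Longrightarrow> {a..b} \<subseteq> S \<Longrightarrow> norm (integral {a..b} f) \<le> M) \<Longrightarrow> integral_bdd_on f S M"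
  unfolding integral_bdd_on_def by blast

lemma integral_bdd_on_mono:
  "integral_bdd_on f T M \<Longrightarrow> S \<subseteq> T \<Longrightarrow> M \<le> N \<Longrightarrow> integral_bdd_on f S N"
  unfolding integral_bdd_on_def by (meson order_trans)

text \<open>An interval straddling \<open>c\<close> is cut there. This glues regions treated by
  different arguments at the price of adding their bounds.\<close>

lemma integral_bdd_on_split:
  assumes f: "continuous_on UNIV f"
    and l: "integral_bdd_on f (S \<inter> {..c}) M" and r: "integral_bdd_on f (S \<inter> {c..}) N"
  shows "integral_bdd_on f S (M + N)"
proof (rule integral_bdd_onI)
  have nn: "0 \<le> M" "0 \<le> N" using l r unfolding integral_bdd_on_def by auto
  then show "0 \<le> M + N" by simp
  fix a b :: real assume ab: "a \<le> b" "{a..b} \<subseteq> S"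
  have L: "norm (integral {u..v} f) \<le> M" if "u \<le> v" "v \<le> c" "{u..v} \<subseteq> S" for u v
    using l that unfolding integral_bdd_on_def by fastforce
  have R: "norm (integral {u..v} f) \<le> N" if "u \<le> v" "c \<le> u" "{u..v} \<subseteq> S" for u v
    using r that unfolding integral_bdd_on_def by fastforce
  consider "b \<le> c" | "c \<le> a" | "a \<le> c" "c \<le> b" by linarith
  then show "norm (integral {a..b} f) \<le> M + N"
  proof cases
    case 1
    then show ?thesis using L[of a b] ab nn by simp
  next
    case 2
    then show ?thesis using R[of a b] ab nn by simp
  next
    case 3
    have "integral {a..c} f + integral {c..b} f = integral {a..b} f"
      by (intro Henstock_Kurzweil_Integration.integral_combine 3 integrable_continuous_real
          continuous_on_subset[OF f]) auto
    moreover have "norm (integral {a..c} f) \<le> M" "norm (integral {c..b} f) \<le> N"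
      using L[of a c] R[of c b] 3 ab by fastforce+
    ultimately show ?thesis
      using norm_triangle_ineq[of "integral {a..c} f" "integral {c..b} f"] by simp
  qed
qed

text \<open>Used near a stationary point, where there is no oscillation to exploit and the length of
  the window is the bound.\<close>

lemma integral_bdd_on_Icc:
  assumes f: "continuous_on UNIV f" and B: "\<And>x. norm (f x) \<le> 1" and "u \<le> v"
  shows "integral_bdd_on f {u..v} (v - u)"
proof (rule integral_bdd_onI)
  fix a b :: real assume ab: "a \<le> b" "{a..b} \<subseteq> {u..v}"
  have "norm (integral {a..b} f) \<le> 1 * (b - a)"
    using B by (intro integral_bound continuous_on_subset[OF f] ab) auto
  then show "norm (integral {a..b} f) \<le> v - u" using ab by auto
qed (use assms in simp)

text \<open>Serves the end \<open>x \<rightarrow> -\<infinity>\<close>, which is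
  \<open>t \<rightarrow> 0\<close> in the original variable; the dominating exponential is
  integrated exactly.\<close>

lemma integral_bdd_on_exp:
  fixes f :: "real \<Rightarrow> 'a::euclidean_space"
  assumes f: "continuous_on UNIV f" and "0 \<le> K" "0 < k"
    and B: "\<And>x. x \<le> c \<Longrightarrow> norm (f x) \<le> K * exp (k * x)"
  shows "integral_bdd_on f {..c} (K / k * exp (k * c))"
proof (rule integral_bdd_onI)
  fix a b :: real assume ab: "a \<le> b" "{a..b} \<subseteq> {..c}"
  have i: "((\<lambda>x. K * exp (k * x)) has_integral (K / k * exp (k * b) - K / k * exp (k * a))) {a..b}"
    using \<open>0 < k\<close> by (intro fundamental_theorem_of_calculus ab)
      (auto intro!: derivative_eq_intros simp: has_real_derivative_iff_has_vector_derivative[symmetric])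
  have "norm (integral {a..b} f) \<le> integral {a..b} (\<lambda>x. K * exp (k * x))"
    using B ab by (intro integral_norm_bound_integral integrable_continuous_real
        continuous_on_subset[OF f] has_integral_integrable[OF i]) auto
  also have "\<dots> \<le> K / k * exp (k * b)"
    using integral_unique[OF i] assms by simp
  also have "\<dots> \<le> K / k * exp (k * c)"
    using assms ab by (intro mult_left_mono) auto
  finally show "norm (integral {a..b} f) \<le> K / k * exp (k * c)" .
qed (use assms in simp)

text \<open>Transfers bounds from \<open>cis\<close> to \<open>sin\<close> (with
  \<open>h = Im\<close>) and from a real integrand to its multiple by
  \<open>2 * \<i>\<close>.\<close>

lemma integral_bdd_on_linear:
  fixes f :: "real \<Rightarrow> 'a::euclidean_space" and h :: "'a \<Rightarrow> 'b::euclidean_space"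
  assumes f: "continuous_on UNIV f" and h: "bounded_linear h"
    and K: "\<And>z. norm (h z) \<le> K * norm z" and "0 \<le> K" and M: "integral_bdd_on f S M"
  shows "integral_bdd_on (\<lambda>x. h (f x)) S (K * M)"
proof (rule integral_bdd_onI)
  show "0 \<le> K * M" using assms unfolding integral_bdd_on_def by simp
  fix a b :: real assume ab: "a \<le> b" "{a..b} \<subseteq> S"
  have "f integrable_on {a..b}"
    by (intro integrable_continuous_real continuous_on_subset[OF f]) auto
  from integral_linear[OF this h] have "integral {a..b} (\<lambda>x. h (f x)) = h (integral {a..b} f)"
    by (simp add: o_def)
  also have "norm \<dots> \<le> K * norm (integral {a..b} f)" by (rule K)
  also have "\<dots> \<le> K * M"
    using M ab \<open>0 \<le> K\<close> unfolding integral_bdd_on_def by (intro mult_left_mono) auto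
  finally show "norm (integral {a..b} (\<lambda>x. h (f x))) \<le> K * M" .
qed

lemma integral_bdd_on_diff:
  assumes f: "continuous_on UNIV f" and g: "continuous_on UNIV g"
    and M: "integral_bdd_on f S M" and N: "integral_bdd_on g S N"
  shows "integral_bdd_on (\<lambda>x. f x - g x) S (M + N)"
proof (rule integral_bdd_onI)
  show "0 \<le> M + N" using assms unfolding integral_bdd_on_def by simp
  fix a b :: real assume ab: "a \<le> b" "{a..b} \<subseteq> S"
  have "f integrable_on {a..b}" "g integrable_on {a..b}"
    by (intro integrable_continuous_real continuous_on_subset[OF f] continuous_on_subset[OF g]; simp)+
  then have "integral {a..b} (\<lambda>x. f x - g x) = integral {a..b} f - integral {a..b} g"
    by (rule integral_diff)
  moreover have "norm (integral {a..b} f) \<le> M" "norm (integral {a..b} g) \<le> N"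
    using M N ab unfolding integral_bdd_on_def by auto
  ultimately show "norm (integral {a..b} (\<lambda>x. f x - g x)) \<le> M + N"
    using norm_triangle_ineq4[of "integral {a..b} f" "integral {a..b} g"] by simp
qed

section \<open>Convergence of improper integrals\<close>

text \<open>Smallness over all subintervals of a tail is the Cauchy condition, so conditionally
  convergent oscillatory integrals are covered.\<close>

lemma integral_tendsto_at_top:
  fixes g :: "real \<Rightarrow> 'a::euclidean_space"
  assumes g: "continuous_on UNIV g" and tail: "\<And>e. 0 < e \<Longrightarrow> \<exists>N. integral_bdd_on g {N..} e"
  shows "\<exists>L. ((\<lambda>b. integral {0..b} g) \<longlongrightarrow> L) at_top"
proof -
  define G where "G b = integral {0..b} g" for b
  have comb: "G v - G u = integral {u..v} g" if "0 \<le> u" "u \<le> v" for u v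
  proof -
    have "integral {0..u} g + integral {u..v} g = integral {0..v} g"
      by (intro Henstock_Kurzweil_Integration.integral_combine that integrable_continuous_real
          continuous_on_subset[OF g]) auto
    then show ?thesis unfolding G_def by (metis add_diff_cancel_left')
  qed
  have ev: "\<exists>N\<ge>0. \<forall>u v. N \<le> u \<longrightarrow> u \<le> v \<longrightarrow> norm (G v - G u) \<le> e" if e: "0 < e" for e
  proof -
    obtain N where N: "integral_bdd_on g {N..} e" using tail[OF e] by blast
    show ?thesis
      using N comb unfolding integral_bdd_on_def
      by (intro exI[of _ "max 0 N"]) (auto intro!: order_trans)
  qed
  \<comment> \<open>Integer endpoints give a Cauchy sequence, hence the candidate limit.\<close>
  have "Cauchy (\<lambda>n. G (real n))"
  proof (rule metric_CauchyI)
    fix e :: real assume "0 < e"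
    then obtain N where N: "N \<ge> 0" "\<And>u v. N \<le> u \<Longrightarrow> u \<le> v \<Longrightarrow> norm (G v - G u) \<le> e / 2"
      using ev[of "e / 2"] by auto
    obtain M where M: "N \<le> real M" using real_arch_simple by blast
    have "dist (G (real m)) (G (real n)) < e" if "m \<ge> M" "n \<ge> M" for m n
    proof (cases "m \<le> n")
      case True
      then have "norm (G n - G m) \<le> e / 2" using M that by (intro N(2)) auto
      then show ?thesis using \<open>0 < e\<close> by (simp add: dist_norm norm_minus_commute)
    next
      case False
      then have "norm (G m - G n) \<le> e / 2" using M that by (intro N(2)) auto
      then show ?thesis using \<open>0 < e\<close> by (simp add: dist_norm)
    qed
    then show "\<exists>M. \<forall>m\<ge>M. \<forall>n\<ge>M. dist (G (real m)) (G (real n)) < e" by blast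
  qed
  then obtain L where L: "(\<lambda>n. G (real n)) \<longlonglongrightarrow> L"
    using Cauchy_convergent_iff convergent_def by blast
  have "(G \<longlongrightarrow> L) at_top"
  proof (rule tendstoI)
    fix e :: real assume "0 < e"
    then obtain N where N: "N \<ge> 0" "\<And>u v. N \<le> u \<Longrightarrow> u \<le> v \<Longrightarrow> norm (G v - G u) \<le> e / 2"
      using ev[of "e / 2"] by auto
    have "dist (G u) L < e" if "N \<le> u" for u
    proof -
      \<comment> \<open>For a real endpoint \<open>u\<close>, let the integer endpoint tend to
        infinity in the Cauchy estimate; \<open>e / 2\<close> leaves room for the strict
        inequality.\<close>
      have "(\<lambda>n. norm (G (real n) - G u)) \<longlonglongrightarrow> norm (L - G u)"
        by (intro tendsto_intros L)
      moreover have "eventually (\<lambda>n. norm (G (real n) - G u) \<le> e / 2) sequentially"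
        using eventually_ge_at_top[of "nat \<lceil>u\<rceil>"]
        by eventually_elim (use N that in \<open>auto intro!: N simp: le_nat_iff nat_le_iff ceiling_le_iff\<close>)
      ultimately have "norm (L - G u) \<le> e / 2"
        by (intro tendsto_upperbound) auto
      then show ?thesis using \<open>0 < e\<close> by (simp add: dist_norm norm_minus_commute)
    qed
    then show "eventually (\<lambda>x. dist (G x) L < e) at_top"
      unfolding eventually_at_top_linorder by blast
  qed
  then show ?thesis unfolding G_def by blast
qed

text \<open>The reflection \<open>x \<mapsto> - x\<close> reduces this to the limit at
  \<open>+\<infinity>\<close>.\<close>

lemma integral_tendsto_at_bot:
  fixes g :: "real \<Rightarrow> 'a::euclidean_space"
  assumes g: "continuous_on UNIV g" and tail: "\<And>e. 0 < e \<Longrightarrow> \<exists>N. integral_bdd_on g {..N} e"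
  shows "\<exists>L. ((\<lambda>a. integral {a..0} g) \<longlongrightarrow> L) at_bot"
proof -
  have "\<exists>L. ((\<lambda>b. integral {0..b} (\<lambda>x. g (- x))) \<longlongrightarrow> L) at_top"
  proof (rule integral_tendsto_at_top)
    show "continuous_on UNIV (\<lambda>x. g (- x))"
      by (intro continuous_on_compose2[OF g] continuous_intros) auto
    fix e :: real assume "0 < e"
    then obtain N where N: "integral_bdd_on g {..N} e" using tail by blast
    have "integral_bdd_on (\<lambda>x. g (- x)) {- N..} e"
    proof (rule integral_bdd_onI)
      fix a b :: real assume ab: "a \<le> b" "{a..b} \<subseteq> {- N..}"
      have "integral {a..b} (\<lambda>x. g (- x)) = integral {-b..-a} g"
        using Henstock_Kurzweil_Integration.integral_reflect_real[of "-a" "-b" g] by simp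
      then show "norm (integral {a..b} (\<lambda>x. g (- x))) \<le> e"
        using N ab unfolding integral_bdd_on_def by auto
    qed (use \<open>0 < e\<close> in simp)
    then show "\<exists>N. integral_bdd_on (\<lambda>x. g (- x)) {N..} e" by blast
  qed
  then obtain L where "((\<lambda>b. integral {0..b} (\<lambda>x. g (- x))) \<longlongrightarrow> L) at_top" by blast
  moreover have "integral {0..b} (\<lambda>x. g (- x)) = integral {-b..0} g" for b
    using Henstock_Kurzweil_Integration.integral_reflect_real[of 0 "-b" g] by simp
  ultimately have "((\<lambda>b. integral {-b..0} g) \<longlongrightarrow> L) at_top" by simp
  from filterlim_compose[OF this filterlim_uminus_at_top_at_bot] show ?thesis by auto
qed

lemma integral_exp_tail_bot:
  fixes f :: "real \<Rightarrow> 'a::euclidean_space"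
  assumes f: "continuous_on UNIV f" and "0 \<le> K" "0 < k"
    and B: "\<And>x. x \<le> 0 \<Longrightarrow> norm (f x) \<le> K * exp (k * x)" and "0 < e"
  shows "\<exists>N. integral_bdd_on f {..N} e"
proof -
  have "((\<lambda>c. K / k * exp (k * c)) \<longlongrightarrow> K / k * 0) at_bot"
    by (intro tendsto_intros filterlim_compose[OF exp_at_bot]
        filterlim_tendsto_pos_mult_at_bot[OF tendsto_const \<open>0 < k\<close>] filterlim_ident)
  then have "eventually (\<lambda>c. K / k * exp (k * c) < e) at_bot"
    using \<open>0 < e\<close> by (intro order_tendstoD(2)) auto
  then obtain N where N: "\<And>c. c \<le> N \<Longrightarrow> K / k * exp (k * c) < e"
    unfolding eventually_at_bot_linorder by blast
  \<comment> \<open>The cut is capped at 0 because the decay is assumed only for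
    \<open>x \<le> 0\<close>.\<close>
  have "integral_bdd_on f {..min N 0} (K / k * exp (k * min N 0))"
    using B by (intro integral_bdd_on_exp assms) auto
  then have "integral_bdd_on f {..min N 0} e"
    using N[of "min N 0"] by (elim integral_bdd_on_mono) auto
  then show ?thesis by blast
qed

section \<open>Principal values in the logarithmic variable\<close>

text \<open>Folds \<open>t\<close> with \<open>- t\<close> and substitutes \<open>t = exp x\<close>.
  The Jacobian \<open>exp x\<close> will cancel the kernel \<open>1 / t\<close>, and the truncation
  becomes a compact interval.\<close>

lemma truncated_integral_exp:
  fixes f :: "real \<Rightarrow> complex"
  assumes f: "continuous_on (- {0}) f" and "0 < r" "r \<le> R"
  shows "truncated_integral f r R =
    integral {ln r..ln R} (\<lambda>x. exp x *\<^sub>R (f (exp x) + f (- exp x)))"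
proof -
  have sub: "{r..R} \<subseteq> - {0}" "{-R..-r} \<subseteq> - {0}" using assms by auto
  have si: "set_integrable lborel {r<..<R} f" "set_integrable lborel {-R<..<-r} f"
    by (rule set_integrable_subset[OF borel_integrable_atLeastAtMost'[OF continuous_on_subset[OF f sub(1)]]],
        auto)
      (rule set_integrable_subset[OF borel_integrable_atLeastAtMost'[OF continuous_on_subset[OF f sub(2)]]],
        auto)
  have cf': "continuous_on {r..R} (\<lambda>t. f (- t))"
    using assms by (intro continuous_on_compose2[OF f] continuous_intros) auto
  have cf: "continuous_on {r..R} (\<lambda>t. f t + f (- t))"
    using sub by (intro continuous_on_add cf' continuous_on_subset[OF f])
  have sub': "exp ` {ln r..ln R} \<subseteq> {r..R}"
  proof
    fix y assume "y \<in> exp ` {ln r..ln R}"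
    then obtain x where "ln r \<le> x" "x \<le> ln R" "y = exp x" by auto
    then show "y \<in> {r..R}"
      using assms exp_le_cancel_iff[of "ln r" x] exp_le_cancel_iff[of x "ln R"] by simp
  qed
  have "{t. r < \<bar>t\<bar> \<and> \<bar>t\<bar> < R} = {r<..<R} \<union> {-R<..<-r}"
    using assms by auto
  then have "truncated_integral f r R = (LINT t:{r<..<R}|lborel. f t) + (LINT t:{-R<..<-r}|lborel. f t)"
    unfolding truncated_integral_def using assms by (simp only:) (intro set_integral_Un si, auto)
  also have "\<dots> = integral {r..R} f + integral {-R..-r} f"
    using set_borel_integral_eq_integral(2)[OF si(1)] set_borel_integral_eq_integral(2)[OF si(2)]
    by (simp add: integral_open_interval_real)
  also have "\<dots> = integral {r..R} f + integral {r..R} (\<lambda>t. f (- t))"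
    using Henstock_Kurzweil_Integration.integral_reflect_real[of "-r" "-R" f] by simp
  also have "\<dots> = integral {r..R} (\<lambda>t. f t + f (- t))"
    using cf' sub by (intro integral_add[symmetric] integrable_continuous_real continuous_on_subset[OF f])
  also have "\<dots> = integral {exp (ln r)..exp (ln R)} (\<lambda>t. f t + f (- t))"
    using assms by simp
  also have "\<dots> = integral {ln r..ln R} (\<lambda>x. exp x *\<^sub>R (f (exp x) + f (- exp x)))"
    using assms
    by (intro integral_unique[symmetric] has_integral_substitution[where c = r and d = R] cf sub')
      (auto intro!: derivative_eq_intros)
  finally show ?thesis .
qed

text \<open>Justifies the definite description in \<open>pv_integral\<close>; the product filter is
  nontrivial.\<close>

lemma has_pv_integral_unique: "has_pv_integral f I \<Longrightarrow> has_pv_integral f J \<Longrightarrow> I = J"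
  unfolding has_pv_integral_def
  by (rule tendsto_unique) (auto simp: prod_filter_eq_bot)

text \<open>Reduces the theorem to the logarithmic integrand \<open>g\<close>: the two tail
  conditions give existence of the principal value, the global bound passes to the limit.\<close>

lemma pv_integral_bound:
  fixes f g :: "real \<Rightarrow> complex"
  assumes f: "continuous_on (- {0}) f" and g: "continuous_on UNIV g"
    and fg: "\<And>x. exp x *\<^sub>R (f (exp x) + f (- exp x)) = g x"
    and M: "integral_bdd_on g UNIV M"
    and top: "\<And>e. 0 < e \<Longrightarrow> \<exists>N. integral_bdd_on g {N..} e"
    and bot: "\<And>e. 0 < e \<Longrightarrow> \<exists>N. integral_bdd_on g {..N} e"
  shows "pv_convergent f \<and> cmod (pv_integral f) \<le> M"
proof -
  obtain L1 where L1: "((\<lambda>b. integral {0..b} g) \<longlongrightarrow> L1) at_top"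
    using integral_tendsto_at_top[OF g top] by blast
  obtain L2 where L2: "((\<lambda>a. integral {a..0} g) \<longlongrightarrow> L2) at_bot"
    using integral_tendsto_at_bot[OF g bot] by blast
  let ?F = "at_right (0::real) \<times>\<^sub>F (at_top :: real filter)"
  \<comment> \<open>Cutting at \<open>x = 0\<close> decouples the joint limit into two one-variable
    limits.\<close>
  have lim0: "((\<lambda>(r, R). integral {ln r..0} g + integral {0..ln R} g) \<longlongrightarrow> L2 + L1) ?F"
    unfolding case_prod_unfold
    by (intro tendsto_add filterlim_compose[OF L2] filterlim_compose[OF L1]
        filterlim_compose[OF ln_at_0] filterlim_compose[OF ln_at_top] filterlim_fst filterlim_snd)
  \<comment> \<open>Eventually \<open>r < 1 < R\<close>, so 0 lies between \<open>ln r\<close> and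
    \<open>ln R\<close> and the two pieces combine.\<close>
  have ev: "eventually (\<lambda>x. 0 < fst x \<and> fst x < 1 \<and> 1 < snd x) ?F"
    unfolding eventually_prod_filter
    by (intro exI[of _ "\<lambda>r. 0 < r \<and> r < 1"] exI[of _ "\<lambda>R. 1 < R"] conjI eventually_gt_at_top)
      (auto intro: eventually_at_rightI[of 0 1])
  have eq: "integral {ln r..0} g + integral {0..ln R} g = truncated_integral f r R"
    "truncated_integral f r R = integral {ln r..ln R} g" if "0 < r" "r < 1" "1 < R" for r R
  proof -
    show *: "truncated_integral f r R = integral {ln r..ln R} g"
      using that by (subst truncated_integral_exp[OF f]) (auto simp: fg)
    show "integral {ln r..0} g + integral {0..ln R} g = truncated_integral f r R"
      unfolding * using that
      by (intro Henstock_Kurzweil_Integration.integral_combine integrable_continuous_real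
          continuous_on_subset[OF g]) auto
  qed
  have lim: "((\<lambda>(r, R). truncated_integral f r R) \<longlongrightarrow> L2 + L1) ?F"
    by (rule Lim_transform_eventually[OF lim0 eventually_mono[OF ev]]) (auto simp: eq(1))
  then have pv: "has_pv_integral f (L2 + L1)" unfolding has_pv_integral_def .
  then have "pv_integral f = L2 + L1"
    unfolding pv_integral_def by (intro the_equality has_pv_integral_unique)
  moreover have "norm (L2 + L1) \<le> M"
  proof (rule tendsto_upperbound[OF tendsto_norm[OF lim]])
    have "norm (integral {ln r..ln R} g) \<le> M" if "0 < r" "r < 1" "1 < R" for r R :: real
      using M that unfolding integral_bdd_on_def by simp
    then show "eventually (\<lambda>x. norm (case x of (r, R) \<Rightarrow> truncated_integral f r R) \<le> M) ?F"
      using ev by (auto elim!: eventually_mono simp: eq(2))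
  qed (auto simp: prod_filter_eq_bot)
  ultimately show ?thesis using pv unfolding pv_convergent_def by auto
qed

section \<open>Phases\<close>

text \<open>With \<open>t = exp x\<close> this is
  \<open>\<alpha> * t + \<beta> * t powr \<epsilon>\<close>. Differentiation in \<open>x\<close>
  only multiplies \<open>\<beta>\<close> by \<open>\<epsilon>\<close>.\<close>

definition phase :: "real \<Rightarrow> real \<Rightarrow> real \<Rightarrow> real \<Rightarrow> real" where
  "phase \<alpha> \<beta> \<epsilon> x = \<alpha> * exp x + \<beta> * exp (\<epsilon> * x)"

lemma phase_has_derivative:
  "(phase \<alpha> \<beta> \<epsilon> has_real_derivative phase \<alpha> (\<beta> * \<epsilon>) \<epsilon> x) (at x)"
  unfolding phase_def by (auto intro!: derivative_eq_intros)

lemma continuous_on_phase [continuous_intros]: "continuous_on A (phase \<alpha> \<beta> \<epsilon>)"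
  unfolding phase_def by (intro continuous_intros)

lemma continuous_on_cis_phase: "continuous_on A (\<lambda>x. cis (phase \<alpha> \<beta> \<epsilon> x))"
  by (intro continuous_intros)

lemma continuous_on_sin_phase: "continuous_on A (\<lambda>x. sin (phase \<alpha> \<beta> \<epsilon> x))"
  by (intro continuous_intros)

lemma phase_factor: "phase \<alpha> \<beta> \<epsilon> x = exp x * (\<alpha> + \<beta> * exp ((\<epsilon> - 1) * x))"
  unfolding phase_def by (simp add: algebra_simps flip: exp_add)

text \<open>Up to the positive factor \<open>exp x\<close> a phase is the monotone function
  \<open>h\<close>, so cutting at a zero of \<open>h\<close> separates the signs. If
  \<open>h\<close> has no zero, its sign is constant by the intermediate value theorem and any cut
  point will do.\<close>

lemma phase_sign_change:
  obtains c where "sign_const_on (phase \<alpha> \<beta> \<epsilon>) {..c}" "sign_const_on (phase \<alpha> \<beta> \<epsilon>) {c..}"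
proof -
  define h where "h x = \<alpha> + \<beta> * exp ((\<epsilon> - 1) * x)" for x
  have ph: "phase \<alpha> \<beta> \<epsilon> x = exp x * h x" for x
    unfolding h_def by (rule phase_factor)
  have sg: "sign_const_on (phase \<alpha> \<beta> \<epsilon>) S" if "sign_const_on h S" for S
    using that unfolding sign_const_on_def ph by (auto simp: zero_le_mult_iff mult_le_0_iff)
  have mono: "(\<forall>x y. x \<le> y \<longrightarrow> h x \<le> h y) \<or> (\<forall>x y. x \<le> y \<longrightarrow> h y \<le> h x)"
  proof -
    have up: "exp ((\<epsilon> - 1) * x) \<le> exp ((\<epsilon> - 1) * y)" if "1 \<le> \<epsilon>" "x \<le> y" for x y
      using that by (simp add: mult_left_mono)
    have down: "exp ((\<epsilon> - 1) * y) \<le> exp ((\<epsilon> - 1) * x)" if "\<epsilon> \<le> 1" "x \<le> y" for x y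
      using that by (simp add: mult_left_mono_neg)
    show ?thesis
      unfolding h_def using up down linear[of 1 \<epsilon>] linear[of 0 \<beta>]
      by (meson add_left_mono mult_left_mono mult_left_mono_neg)
  qed
  show ?thesis
  proof (cases "\<exists>c. h c = 0")
    case True
    then obtain c where c: "h c = 0" ..
    have "sign_const_on h {..c}" "sign_const_on h {c..}"
      using mono unfolding sign_const_on_def Ball_def atMost_iff atLeast_iff by (metis c)+
    then show ?thesis using that sg by blast
  next
    case False
    have ch: "continuous_on A h" for A
      unfolding h_def by (intro continuous_intros)
    have "sign_const_on h UNIV"
    proof (rule ccontr)
      assume "\<not> sign_const_on h UNIV"
      then obtain x y where xy: "h x < 0" "0 < h y"
        unfolding sign_const_on_def by (auto simp: not_le)
      have "\<exists>c. h c = 0"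
        using IVT'[of h x 0 y] IVT2'[of h x 0 y] xy ch by (cases "x \<le> y") auto
      then show False using False by blast
    qed
    then show ?thesis using that[of 0] sg sign_const_on_subset by (metis subset_UNIV)
  qed
qed

text \<open>The second derivative is again a phase; cutting at its sign change leaves two regions,
  each contributing \<open>4 / m\<close>.\<close>

lemma integral_cis_phase_bdd:
  assumes "0 < m" and m: "\<And>x. x \<in> S \<Longrightarrow> m \<le> \<bar>phase \<alpha> (\<beta> * \<epsilon>) \<epsilon> x\<bar>"
  shows "integral_bdd_on (\<lambda>x. cis (phase \<alpha> \<beta> \<epsilon> x)) S (8 / m)"
proof -
  obtain c where c: "sign_const_on (phase \<alpha> (\<beta> * \<epsilon> * \<epsilon>) \<epsilon>) {..c}"
    "sign_const_on (phase \<alpha> (\<beta> * \<epsilon> * \<epsilon>) \<epsilon>) {c..}"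
    by (rule phase_sign_change)
  have *: "integral_bdd_on (\<lambda>x. cis (phase \<alpha> \<beta> \<epsilon> x)) (S \<inter> T) (4 / m)"
    if T: "sign_const_on (phase \<alpha> (\<beta> * \<epsilon> * \<epsilon>) \<epsilon>) T" for T
  proof (rule integral_bdd_onI)
    fix a b :: real assume ab: "a \<le> b" "{a..b} \<subseteq> S \<inter> T"
    then show "norm (integral {a..b} (\<lambda>x. cis (phase \<alpha> \<beta> \<epsilon> x))) \<le> 4 / m"
      using m sign_const_on_subset[OF T] \<open>0 < m\<close>
      by (intro van_der_corput[OF _ _ phase_has_derivative phase_has_derivative]) auto
  qed (use \<open>0 < m\<close> in simp)
  show ?thesis
    using integral_bdd_on_split[OF continuous_on_cis_phase *[OF c(1)] *[OF c(2)]] by simp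
qed

text \<open>Same cut at the sign change of the second derivative, hence twice
  \<open>4 + 2 * C\<^sup>2\<close>.\<close>

lemma integral_sin_phase_bdd:
  assumes "0 \<le> C" and C: "\<And>x. x \<in> S \<Longrightarrow> \<bar>phase \<alpha> \<beta> \<epsilon> x\<bar> \<le> C * \<bar>phase \<alpha> (\<beta> * \<epsilon>) \<epsilon> x\<bar>"
    and S: "sign_const_on (phase \<alpha> (\<beta> * \<epsilon>) \<epsilon>) S"
  shows "integral_bdd_on (\<lambda>x. sin (phase \<alpha> \<beta> \<epsilon> x)) S (8 + 4 * C\<^sup>2)"
proof -
  obtain c where c: "sign_const_on (phase \<alpha> (\<beta> * \<epsilon> * \<epsilon>) \<epsilon>) {..c}"
    "sign_const_on (phase \<alpha> (\<beta> * \<epsilon> * \<epsilon>) \<epsilon>) {c..}"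
    by (rule phase_sign_change)
  have *: "integral_bdd_on (\<lambda>x. sin (phase \<alpha> \<beta> \<epsilon> x)) (S \<inter> T) (4 + 2 * C\<^sup>2)"
    if T: "sign_const_on (phase \<alpha> (\<beta> * \<epsilon> * \<epsilon>) \<epsilon>) T" for T
  proof (rule integral_bdd_onI)
    fix a b :: real assume ab: "a \<le> b" "{a..b} \<subseteq> S \<inter> T"
    then show "norm (integral {a..b} (\<lambda>x. sin (phase \<alpha> \<beta> \<epsilon> x))) \<le> 4 + 2 * C\<^sup>2"
      using C sign_const_on_subset[OF T] sign_const_on_subset[OF S] \<open>0 \<le> C\<close>
      unfolding real_norm_def
      by (intro integral_sin_phase_bound[OF _ _ phase_has_derivative phase_has_derivative]) auto
  qed (use \<open>0 \<le> C\<close> in simp)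
  show ?thesis
    using integral_bdd_on_split[OF continuous_on_sin_phase *[OF c(1)] *[OF c(2)]] by simp
qed

text \<open>Far out the derivative exceeds \<open>8 / e\<close>, and the first derivative test then
  gives the bound \<open>e\<close>.\<close>

lemma integral_cis_phase_tail:
  assumes "filterlim (\<lambda>x. \<bar>phase \<alpha> (\<beta> * \<epsilon>) \<epsilon> x\<bar>) at_top at_top" and "0 < e"
  shows "\<exists>N. integral_bdd_on (\<lambda>x. cis (phase \<alpha> \<beta> \<epsilon> x)) {N..} e"
proof -
  obtain N where "\<And>x. N \<le> x \<Longrightarrow> 8 / e \<le> \<bar>phase \<alpha> (\<beta> * \<epsilon>) \<epsilon> x\<bar>"
    using assms(1) unfolding filterlim_at_top eventually_at_top_linorder by blast
  then have "integral_bdd_on (\<lambda>x. cis (phase \<alpha> \<beta> \<epsilon> x)) {N..} (8 / (8 / e))"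
    using \<open>0 < e\<close> by (intro integral_cis_phase_bdd) auto
  then show ?thesis using \<open>0 < e\<close> by auto
qed

lemma filterlim_abs_exp_mult_at_top:
  assumes "(h \<longlongrightarrow> c) at_top" "c \<noteq> 0" "0 < k"
  shows "filterlim (\<lambda>x::real. \<bar>exp (k * x) * h x\<bar>) at_top at_top"
proof -
  have "filterlim (\<lambda>x::real. exp (k * x)) at_top at_top"
    by (intro filterlim_compose[OF exp_at_top] filterlim_tendsto_pos_mult_at_top[OF tendsto_const \<open>0 < k\<close>]
        filterlim_ident)
  from filterlim_tendsto_pos_mult_at_top[OF tendsto_rabs[OF assms(1)] _ this]
  show ?thesis using assms(2) by (simp add: abs_mult mult.commute)
qed

lemma exp_mult_tendsto_0:
  assumes "k < 0"
  shows "((\<lambda>x::real. exp (k * x)) \<longlongrightarrow> 0) at_top"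
  by (intro filterlim_compose[OF exp_at_bot] filterlim_tendsto_neg_mult_at_bot[OF tendsto_const assms]
      filterlim_ident)

text \<open>For \<open>\<epsilon> < 1\<close> the term \<open>\<alpha> * exp x\<close>
  dominates.\<close>

lemma phase_at_top_lt_1:
  assumes "\<epsilon> < 1" "\<alpha> \<noteq> 0"
  shows "filterlim (\<lambda>x. \<bar>phase \<alpha> \<beta> \<epsilon> x\<bar>) at_top at_top"
proof -
  have "((\<lambda>x. \<alpha> + \<beta> * exp ((\<epsilon> - 1) * x)) \<longlongrightarrow> \<alpha> + \<beta> * 0) at_top"
    using assms by (intro tendsto_intros exp_mult_tendsto_0) auto
  from filterlim_abs_exp_mult_at_top[OF this, of 1] show ?thesis
    using assms unfolding phase_factor by simp
qed

text \<open>For \<open>\<epsilon> > 1\<close> the term \<open>\<beta> * exp (\<epsilon> * x)\<close>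
  dominates and is factored out instead.\<close>

lemma phase_at_top_gt_1:
  assumes "1 < \<epsilon>" "\<beta> \<noteq> 0"
  shows "filterlim (\<lambda>x. \<bar>phase \<alpha> \<beta> \<epsilon> x\<bar>) at_top at_top"
proof -
  have "((\<lambda>x. \<alpha> * exp ((1 - \<epsilon>) * x) + \<beta>) \<longlongrightarrow> \<alpha> * 0 + \<beta>) at_top"
    using assms by (intro tendsto_intros exp_mult_tendsto_0) auto
  from filterlim_abs_exp_mult_at_top[OF this, of \<epsilon>] show ?thesis
    using assms unfolding phase_def by (simp add: algebra_simps flip: exp_add)
qed

section \<open>The odd phase\<close>

text \<open>A lower bound linear in \<open>\<bar>d\<bar>\<close>, hence usable as
  \<open>d = \<epsilon> - 1\<close> tends to 0. For negative exponents the constant 2/3 comes from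
  \<open>1 / (1 + \<bar>d\<bar>) \<le> 1 - 2/3 * \<bar>d\<bar>\<close>, valid for
  \<open>\<bar>d\<bar> \<le> 1/2\<close>.\<close>

lemma exp_diff_1_bounds:
  fixes d y :: real
  assumes "\<bar>d\<bar> \<le> 1/2" "1 \<le> \<bar>y\<bar>"
  shows "2 * \<bar>d\<bar> \<le> 3 * \<bar>exp (d * y) - 1\<bar>"
proof -
  have u: "\<bar>d\<bar> \<le> \<bar>d * y\<bar>"
    using mult_left_mono[OF assms(2), of "\<bar>d\<bar>"] by (simp add: abs_mult)
  show ?thesis
  proof (cases "0 \<le> d * y")
    case True
    then have "\<bar>d\<bar> \<le> d * y" using u by (metis abs_of_nonneg)
    then have "\<bar>d\<bar> \<le> exp (d * y) - 1" using exp_ge_add_one_self[of "d * y"] by linarith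
    then have "2 * \<bar>d\<bar> \<le> 3 * (exp (d * y) - 1)" by (intro mult_mono) auto
    also have "\<dots> \<le> 3 * \<bar>exp (d * y) - 1\<bar>" by (intro mult_left_mono abs_ge_self) simp
    finally show ?thesis .
  next
    case False
    have "exp (d * y) \<le> exp (- \<bar>d\<bar>)"
      using u False by (metis abs_of_neg exp_le_cancel_iff le_minus_iff not_le)
    also have "\<dots> \<le> 1 / (1 + \<bar>d\<bar>)"
      using exp_ge_add_one_self[of "\<bar>d\<bar>"] by (simp add: exp_minus field_simps)
    also have "\<dots> \<le> 1 - 2 / 3 * \<bar>d\<bar>"
    proof -
      have "\<bar>d\<bar> * \<bar>d\<bar> \<le> \<bar>d\<bar> * (1/2)" using assms by (intro mult_left_mono) auto
      then show ?thesis by (simp add: field_simps)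
    qed
    finally have "2 * \<bar>d\<bar> \<le> 3 * - (exp (d * y) - 1)" by simp
    also have "\<dots> \<le> 3 * \<bar>exp (d * y) - 1\<bar>" by (intro mult_left_mono abs_ge_minus_self) simp
    finally show ?thesis .
  qed
qed

lemma integral_sin_odd_phase_bdd:
  assumes e: "1/2 < \<epsilon>" "\<epsilon> < 3/2"
  shows "integral_bdd_on (\<lambda>x. sin (phase (- l) 1 \<epsilon> x)) UNIV 218"
proof -
  \<comment> \<open>With \<open>C = 5\<close> the bound is \<open>8 + 4 * 25 = 108\<close>.\<close>
  have part: "integral_bdd_on (\<lambda>x. sin (phase (- l) 1 \<epsilon> x)) S 108"
    if "\<And>x. x \<in> S \<Longrightarrow> \<bar>phase (- l) 1 \<epsilon> x\<bar> \<le> 5 * \<bar>phase (- l) \<epsilon> \<epsilon> x\<bar>"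
      "sign_const_on (phase (- l) \<epsilon> \<epsilon>) S" for S
    using integral_sin_phase_bdd[of 5 S "-l" 1 \<epsilon>] that by simp
  consider "l \<le> 0" | "\<epsilon> = 1" | "0 < l" "\<epsilon> \<noteq> 1" by linarith
  then show ?thesis
  proof cases
    case 1
    have pos: "0 \<le> phase (- l) \<epsilon> \<epsilon> x" for x
      unfolding phase_def using 1 e by (intro add_nonneg_nonneg mult_nonneg_nonneg) auto
    have "\<bar>phase (- l) 1 \<epsilon> x\<bar> \<le> 5 * \<bar>phase (- l) \<epsilon> \<epsilon> x\<bar>" for x
    proof -
      have "0 \<le> phase (- l) 1 \<epsilon> x"
        unfolding phase_def using 1 by (intro add_nonneg_nonneg mult_nonneg_nonneg) auto
      moreover have "phase (- l) 1 \<epsilon> x \<le> 5 * phase (- l) \<epsilon> \<epsilon> x"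
      proof -
        \<comment> \<open>These two terms sum to \<open>5 * p' - p\<close>.\<close>
        have "0 \<le> 4 * (- l) * exp x" "0 \<le> (5 * \<epsilon> - 1) * exp (\<epsilon> * x)"
          using e 1 by (intro mult_nonneg_nonneg; simp)+
        then show ?thesis unfolding phase_def by (simp only: algebra_simps)
      qed
      ultimately show ?thesis using pos[of x] by simp
    qed
    moreover have "sign_const_on (phase (- l) \<epsilon> \<epsilon>) UNIV"
      using pos unfolding sign_const_on_def by blast
    ultimately have "integral_bdd_on (\<lambda>x. sin (phase (- l) 1 \<epsilon> x)) UNIV 108"
      by (intro part)
    then show ?thesis by (rule integral_bdd_on_mono) auto
  next
    case 2
    \<comment> \<open>For \<open>\<epsilon> = 1\<close> the phase is its own derivative.\<close>
    have "phase (- l) 1 \<epsilon> x = (1 - l) * exp x" for x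
      unfolding phase_def 2 by (simp add: algebra_simps)
    moreover have "sign_const_on (\<lambda>x. (1 - l) * exp x) UNIV"
      unfolding sign_const_on_def by (auto simp: zero_le_mult_iff mult_le_0_iff)
    ultimately have "integral_bdd_on (\<lambda>x. sin (phase (- l) 1 \<epsilon> x)) UNIV 108"
      using 2 by (intro part) (auto simp: sign_const_on_def)
    then show ?thesis by (rule integral_bdd_on_mono) auto
  next
    case 3
    define d where "d = \<epsilon> - 1"
    \<comment> \<open>The zero of the derivative. Centred there, \<open>p'\<close> and
      \<open>p\<close> are, up to a common positive factor, \<open>\<epsilon> * (E - 1)\<close> and
      \<open>E - \<epsilon>\<close> with \<open>E = exp (d * (x - c))\<close>.\<close>
    define c where "c = ln (l / \<epsilon>) / d"
    have d: "d \<noteq> 0" "\<bar>d\<bar> \<le> 1/2" "\<epsilon> = 1 + d" unfolding d_def using 3 e by linarith+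
    have "d * c = ln (l / \<epsilon>)" using d(1) by (simp add: c_def)
    then have "exp (d * c) = l / \<epsilon>" using 3(1) e by simp
    then have l: "l = \<epsilon> * exp (d * c)" using e by simp
    have split_exp: "exp (d * x) = exp (d * c) * exp (d * (x - c))" for x
      by (simp add: algebra_simps flip: exp_add)
    have p1: "phase (- l) \<epsilon> \<epsilon> x = exp x * exp (d * c) * \<epsilon> * (exp (d * (x - c)) - 1)" for x
      unfolding phase_factor l d_def[symmetric] split_exp[of x] by (simp add: algebra_simps)
    have p0: "phase (- l) 1 \<epsilon> x = exp x * exp (d * c) * (exp (d * (x - c)) - \<epsilon>)" for x
      unfolding phase_factor l d_def[symmetric] split_exp[of x] by (simp add: algebra_simps)
    have bound: "\<bar>phase (- l) 1 \<epsilon> x\<bar> \<le> 5 * \<bar>phase (- l) \<epsilon> \<epsilon> x\<bar>" if "1 \<le> \<bar>x - c\<bar>" for x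
    proof -
      have *: "2 * \<bar>d\<bar> \<le> 3 * \<bar>exp (d * (x - c)) - 1\<bar>"
        using d(2) that by (rule exp_diff_1_bounds)
      \<comment> \<open>\<open>E - \<epsilon>\<close> differs from \<open>E - 1\<close> by
        \<open>d\<close>, which is at most \<open>3/2 * \<bar>E - 1\<bar>\<close> away from
        \<open>c\<close>. Together with \<open>\<epsilon> > 1/2\<close> this yields the ratio
        5.\<close>
      have "2 * \<bar>exp (d * (x - c)) - \<epsilon>\<bar> \<le> 5 * \<bar>exp (d * (x - c)) - 1\<bar>"
      proof -
        have "\<bar>exp (d * (x - c)) - \<epsilon>\<bar> \<le> \<bar>exp (d * (x - c)) - 1\<bar> + \<bar>d\<bar>"
          unfolding d(3) by (metis abs_triangle_ineq4 diff_diff_eq)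
        then have "2 * \<bar>exp (d * (x - c)) - \<epsilon>\<bar> \<le> 2 * \<bar>exp (d * (x - c)) - 1\<bar> + 2 * \<bar>d\<bar>" by simp
        also have "\<dots> \<le> 2 * \<bar>exp (d * (x - c)) - 1\<bar> + 3 * \<bar>exp (d * (x - c)) - 1\<bar>"
          using * by (rule add_left_mono)
        finally show ?thesis by simp
      qed
      then have "\<bar>exp (d * (x - c)) - \<epsilon>\<bar> \<le> (5 / 2) * \<bar>exp (d * (x - c)) - 1\<bar>" by simp
      also have "\<dots> \<le> (5 * \<epsilon>) * \<bar>exp (d * (x - c)) - 1\<bar>"
        using e by (intro mult_right_mono) auto
      finally have "exp x * exp (d * c) * \<bar>exp (d * (x - c)) - \<epsilon>\<bar> \<le>
          exp x * exp (d * c) * ((5 * \<epsilon>) * \<bar>exp (d * (x - c)) - 1\<bar>)"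
        by (intro mult_left_mono) auto
      then show ?thesis unfolding p0 p1 using e by (simp add: abs_mult mult_ac)
    qed
    have sg: "sign_const_on (phase (- l) \<epsilon> \<epsilon>) S"
      if "(\<forall>x\<in>S. 0 \<le> d * (x - c)) \<or> (\<forall>x\<in>S. d * (x - c) \<le> 0)" for S
      using that e unfolding sign_const_on_def p1
      by (elim disjE) (auto simp: zero_le_mult_iff mult_le_0_iff)
    have L: "integral_bdd_on (\<lambda>x. sin (phase (- l) 1 \<epsilon> x)) {..c - 1} 108"
    proof (intro part bound sg)
      show "(\<forall>x\<in>{..c - 1}. 0 \<le> d * (x - c)) \<or> (\<forall>x\<in>{..c - 1}. d * (x - c) \<le> 0)"
        by (cases "0 \<le> d") (auto simp: zero_le_mult_iff mult_le_0_iff)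
    qed auto
    have R: "integral_bdd_on (\<lambda>x. sin (phase (- l) 1 \<epsilon> x)) {c + 1..} 108"
    proof (intro part bound sg)
      show "(\<forall>x\<in>{c + 1..}. 0 \<le> d * (x - c)) \<or> (\<forall>x\<in>{c + 1..}. d * (x - c) \<le> 0)"
        by (cases "0 \<le> d") (auto simp: zero_le_mult_iff mult_le_0_iff)
    qed auto
    \<comment> \<open>The window around the stationary point has length 2; the total is
      \<open>108 + 2 + 108 = 218\<close>.\<close>
    have M: "integral_bdd_on (\<lambda>x. sin (phase (- l) 1 \<epsilon> x)) {c - 1..c + 1} ((c + 1) - (c - 1))"
      by (intro integral_bdd_on_Icc continuous_on_sin_phase) auto
    have LM: "integral_bdd_on (\<lambda>x. sin (phase (- l) 1 \<epsilon> x)) {..c + 1} (108 + 2)"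
      by (rule integral_bdd_on_split[OF continuous_on_sin_phase
            integral_bdd_on_mono[OF L] integral_bdd_on_mono[OF M]]) auto
    have "integral_bdd_on (\<lambda>x. sin (phase (- l) 1 \<epsilon> x)) UNIV ((108 + 2) + 108)"
      by (rule integral_bdd_on_split[OF continuous_on_sin_phase, where S = UNIV,
            unfolded Int_UNIV_left, OF LM R])
    then show ?thesis by simp
  qed
qed

lemma integral_sin_odd_phase_tail:
  assumes e: "1/2 < \<epsilon>" "\<epsilon> < 3/2" and "0 < \<delta>"
  shows "\<exists>N. integral_bdd_on (\<lambda>x. sin (phase (- l) 1 \<epsilon> x)) {N..} \<delta>"
proof (cases "\<epsilon> = 1 \<and> l = 1")
  \<comment> \<open>The phase vanishes identically here; in all other cases its derivative is
    unbounded at \<open>+\<infinity>\<close>.\<close>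
  case True
  then have "(\<lambda>x. sin (phase (- l) 1 \<epsilon> x)) = (\<lambda>x. 0)" by (auto simp: phase_def)
  then show ?thesis using \<open>0 < \<delta>\<close> unfolding integral_bdd_on_def by auto
next
  case False
  have lim: "filterlim (\<lambda>x. \<bar>phase (- l) (1 * \<epsilon>) \<epsilon> x\<bar>) at_top at_top"
  proof -
    consider "\<epsilon> < 1" "l \<noteq> 0" | "1 < \<epsilon>" | "\<epsilon> = 1" "l \<noteq> 1" | "l = 0"
      using False by linarith
    then show ?thesis
    proof cases
      case 1
      then show ?thesis by (intro phase_at_top_lt_1) auto
    next
      case 2
      then show ?thesis by (intro phase_at_top_gt_1) auto
    next
      case 3
      then show ?thesis
        using filterlim_abs_exp_mult_at_top[of "\<lambda>_. 1 - l" "1 - l" 1]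
        by (simp add: phase_def algebra_simps)
    next
      case 4
      then show ?thesis
        using filterlim_abs_exp_mult_at_top[of "\<lambda>_. \<epsilon>" \<epsilon> \<epsilon>] e
        by (simp add: phase_def algebra_simps)
    qed
  qed
  obtain N where "integral_bdd_on (\<lambda>x. cis (phase (- l) 1 \<epsilon> x)) {N..} \<delta>"
    using integral_cis_phase_tail[OF lim \<open>0 < \<delta>\<close>] by blast
  from integral_bdd_on_linear[OF continuous_on_cis_phase bounded_linear_Im _ _ this, of 1]
  show ?thesis using abs_Im_le_cmod by auto
qed

lemma pv_odd_phase:
  assumes e: "1/2 < \<epsilon>" "\<epsilon> < 3/2"
  shows "pv_convergent (odd_phase_integrand \<epsilon> l) \<and> cmod (pv_integral (odd_phase_integrand \<epsilon> l)) \<le> 436"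
proof -
  let ?s = "\<lambda>x. sin (phase (- l) 1 \<epsilon> x)"
  let ?h = "\<lambda>y::real. 2 * \<i> * complex_of_real y"
  have h: "bounded_linear ?h"
    by (intro bounded_linear_const_mult bounded_linear_of_real)
  have bdd: "integral_bdd_on (\<lambda>x. ?h (?s x)) S (2 * M)" if "integral_bdd_on ?s S M" for S M
    using integral_bdd_on_linear[OF continuous_on_sin_phase h _ _ that, of 2] by (simp add: norm_mult)
  have bdd2: "\<exists>N. integral_bdd_on (\<lambda>x. ?h (?s x)) (S N) e"
    if "\<And>e. 0 < e \<Longrightarrow> \<exists>N::real. integral_bdd_on ?s (S N) e" "0 < e" for S e
    using that(1)[of "e / 2"] bdd that(2) by fastforce
  show ?thesis
  proof (rule pv_integral_bound[where g = "\<lambda>x. ?h (?s x)"])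
    have "continuous_on (- {0}) (\<lambda>t::real. sgn t)"
      by (auto intro!: continuous_at_imp_continuous_on isCont_sgn)
    then show "continuous_on (- {0}) (odd_phase_integrand \<epsilon> l)"
      unfolding odd_phase_integrand_def by (intro continuous_intros) auto
    show "continuous_on UNIV (\<lambda>x. ?h (?s x))" by (intro continuous_intros)
    show "exp x *\<^sub>R (odd_phase_integrand \<epsilon> l (exp x) + odd_phase_integrand \<epsilon> l (- exp x)) = ?h (?s x)" for x
    proof -
      have 1: "odd_phase_integrand \<epsilon> l (exp x) = cis (phase (- l) 1 \<epsilon> x) / of_real (exp x)"
        by (simp add: odd_phase_integrand_def phase_def cis_conv_exp powr_def algebra_simps flip: exp_add)
      have 2: "odd_phase_integrand \<epsilon> l (- exp x) = - cis (- phase (- l) 1 \<epsilon> x) / of_real (exp x)"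
        by (simp add: odd_phase_integrand_def phase_def cis_conv_exp powr_def algebra_simps flip: exp_add)
      show ?thesis unfolding 1 2
        by (simp add: complex_eq_iff scaleR_conv_of_real field_simps flip: of_real_exp)
    qed
    show "integral_bdd_on (\<lambda>x. ?h (?s x)) UNIV 436"
      using bdd[OF integral_sin_odd_phase_bdd[OF e]] by simp
    show "\<exists>N. integral_bdd_on (\<lambda>x. ?h (?s x)) {N..} d" if "0 < d" for d
      using integral_sin_odd_phase_tail[OF e] that by (rule bdd2)
    \<comment> \<open>For \<open>x \<le> 0\<close> both exponentials are at most
      \<open>exp (x / 2)\<close>, since \<open>\<epsilon> > 1/2\<close>. The constant may depend on
      \<open>l\<close>, because only convergence is at stake.\<close>
    have "\<exists>N. integral_bdd_on ?s {..N} d" if d: "0 < d" for d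
    proof (rule integral_exp_tail_bot[OF continuous_on_sin_phase _ _ _ d, where k = "1/2" and K = "\<bar>l\<bar> + 1"])
      fix x :: real assume x: "x \<le> 0"
      have "norm (?s x) \<le> \<bar>phase (- l) 1 \<epsilon> x\<bar>"
        unfolding real_norm_def by (rule abs_sin_x_le_abs_x)
      also have "\<dots> \<le> \<bar>l\<bar> * exp x + exp (\<epsilon> * x)"
        unfolding phase_def using abs_triangle_ineq[of "- l * exp x" "1 * exp (\<epsilon> * x)"] by (simp add: abs_mult)
      also have "\<dots> \<le> \<bar>l\<bar> * exp (1/2 * x) + exp (1/2 * x)"
        using x e mult_right_mono_neg[of "1/2" \<epsilon> x] by (intro add_mono mult_left_mono) auto
      finally show "norm (?s x) \<le> (\<bar>l\<bar> + 1) * exp (1/2 * x)" by (simp add: algebra_simps)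
    qed auto
    then show "\<exists>N. integral_bdd_on (\<lambda>x. ?h (?s x)) {..N} d" if "0 < d" for d
      using that by (rule bdd2)
  qed
qed

section \<open>The even phase\<close>

lemma integral_cis_even_phase_bdd:
  assumes e: "\<bar>\<epsilon>\<bar> < 1/2" and "l \<noteq> 0"
  shows "integral_bdd_on (\<lambda>x. cis (phase l 1 \<epsilon> x)) {- ln \<bar>l\<bar>..} 36"
proof -
  have big: "1 \<le> \<bar>l\<bar> * exp x" if "x \<in> {- ln \<bar>l\<bar>..}" for x
  proof -
    have "exp (- ln \<bar>l\<bar>) \<le> exp x" using that by simp
    then show ?thesis using \<open>l \<noteq> 0\<close> by (simp add: exp_minus field_simps)
  qed
  have part: "integral_bdd_on (\<lambda>x. cis (phase l 1 \<epsilon> x)) S 16"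
    if "\<And>x. x \<in> S \<Longrightarrow> 1/2 \<le> \<bar>phase l \<epsilon> \<epsilon> x\<bar>" for S
    using integral_cis_phase_bdd[of "1/2" S l 1 \<epsilon>] that by simp
  show ?thesis
  proof (cases "\<epsilon> = 0")
    case True
    have "1/2 \<le> \<bar>phase l \<epsilon> \<epsilon> x\<bar>" if "x \<in> {- ln \<bar>l\<bar>..}" for x
      using big[OF that] unfolding True phase_def by (simp add: abs_mult)
    then have "integral_bdd_on (\<lambda>x. cis (phase l 1 \<epsilon> x)) {- ln \<bar>l\<bar>..} 16" by (rule part)
    then show ?thesis by (rule integral_bdd_on_mono) auto
  next
    case False
    \<comment> \<open>Where the two terms of \<open>p'\<close> have equal modulus; \<open>p'\<close>
      vanishes there exactly when they have opposite signs.\<close>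
    define c where "c = ln (\<bar>l\<bar> / \<bar>\<epsilon>\<bar>) / (\<epsilon> - 1)"
    have c: "\<bar>\<epsilon>\<bar> * exp ((\<epsilon> - 1) * x) = \<bar>l\<bar> * exp ((\<epsilon> - 1) * (x - c))" for x
    proof -
      have "\<bar>l\<bar> = \<bar>\<epsilon>\<bar> * exp ((\<epsilon> - 1) * c)"
        using e False \<open>l \<noteq> 0\<close> by (simp add: c_def)
      then show ?thesis by (simp add: algebra_simps flip: exp_add)
    qed
    \<comment> \<open>Since \<open>\<bar>\<epsilon> - 1\<bar> > 1/2\<close>, distance 2 from
      \<open>c\<close> makes the exponent at least 1 in modulus. Hence
      \<open>\<bar>1 - exp ?u\<bar> \<ge> 1/2\<close>, and the factor
      \<open>\<bar>l\<bar> * exp x \<ge> 1\<close> preserves this.\<close>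
    have low: "1/2 \<le> \<bar>phase l \<epsilon> \<epsilon> x\<bar>" if x: "x \<in> {- ln \<bar>l\<bar>..}" "2 \<le> \<bar>x - c\<bar>" for x
    proof -
      let ?u = "(\<epsilon> - 1) * (x - c)"
      have "(1/2) * 2 \<le> \<bar>\<epsilon> - 1\<bar> * \<bar>x - c\<bar>" using e x(2) by (intro mult_mono) auto
      then have "1 \<le> \<bar>?u\<bar>" by (simp add: abs_mult)
      then consider "1 \<le> ?u" | "?u \<le> - 1" by linarith
      then have "1/2 \<le> \<bar>1 - exp ?u\<bar>"
      proof cases
        case 1
        then show ?thesis using exp_ge_add_one_self[of ?u] by linarith
      next
        case 2
        then have "exp ?u \<le> exp (- 1)" by simp
        also have "\<dots> \<le> 1/2"
          using exp_ge_add_one_self[of 1] by (simp add: exp_minus field_simps)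
        finally show ?thesis by linarith
      qed
      then have "1 * (1/2) \<le> (\<bar>l\<bar> * exp x) * \<bar>1 - exp ?u\<bar>"
        using big[OF x(1)] by (intro mult_mono) auto
      also have "\<dots> = exp x * \<bar>\<bar>l\<bar> - \<bar>\<epsilon>\<bar> * exp ((\<epsilon> - 1) * x)\<bar>"
        unfolding c by (simp add: abs_mult right_diff_distrib[of "\<bar>l\<bar>" 1, simplified, symmetric] mult_ac)
      also have "\<dots> \<le> exp x * \<bar>l + \<epsilon> * exp ((\<epsilon> - 1) * x)\<bar>"
        using abs_triangle_ineq3[of l "- (\<epsilon> * exp ((\<epsilon> - 1) * x))"]
          abs_triangle_ineq2_sym[of l "- (\<epsilon> * exp ((\<epsilon> - 1) * x))"]
        by (intro mult_left_mono) (auto simp: abs_mult)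
      finally show ?thesis unfolding phase_factor by (simp add: abs_mult)
    qed
    let ?S = "{- ln \<bar>l\<bar>..}"
    have L: "integral_bdd_on (\<lambda>x. cis (phase l 1 \<epsilon> x)) (?S \<inter> {..c - 2}) 16"
      by (intro part low) auto
    have R: "integral_bdd_on (\<lambda>x. cis (phase l 1 \<epsilon> x)) (?S \<inter> {c + 2..}) 16"
      by (intro part low) auto
    have M: "integral_bdd_on (\<lambda>x. cis (phase l 1 \<epsilon> x)) {c - 2..c + 2} ((c + 2) - (c - 2))"
      by (intro integral_bdd_on_Icc continuous_on_cis_phase) auto
    have "integral_bdd_on (\<lambda>x. cis (phase l 1 \<epsilon> x)) (?S \<inter> {..c + 2}) (16 + 4)"
      by (rule integral_bdd_on_split[OF continuous_on_cis_phase
            integral_bdd_on_mono[OF L] integral_bdd_on_mono[OF M]]) auto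
    then have "integral_bdd_on (\<lambda>x. cis (phase l 1 \<epsilon> x)) ?S ((16 + 4) + 16)"
      by (rule integral_bdd_on_split[OF continuous_on_cis_phase _ integral_bdd_on_mono[OF R]]) simp_all
    then show ?thesis by simp
  qed
qed

lemma pv_even_phase:
  assumes e: "\<bar>\<epsilon>\<bar> < 1/2"
  shows "pv_convergent (even_phase_integrand \<epsilon> l) \<and> cmod (pv_integral (even_phase_integrand \<epsilon> l)) \<le> 74"
proof -
  let ?g = "\<lambda>x. - 2 * \<i> * (cis (exp (\<epsilon> * x)) * of_real (sin (l * exp x)))"
  let ?p = "\<lambda>l x. cis (phase l 1 \<epsilon> x)"
  \<comment> \<open>Sine as a difference of exponentials produces two phases with coefficients
    \<open>- l\<close> and \<open>l\<close>. The splitting is used only to the right, since each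
    term has modulus 1 as \<open>x \<rightarrow> -\<infinity>\<close>.\<close>
  have eq: "?g x = ?p (- l) x - ?p l x" for x
    unfolding phase_def
    by (simp add: complex_eq_iff sin_add cos_add sin_diff cos_diff algebra_simps)
  have cg: "continuous_on UNIV ?g" by (intro continuous_intros)
  have left: "norm (?g x) \<le> 2 * \<bar>l\<bar> * exp (1 * x)" for x
    using abs_sin_x_le_abs_x[of "l * exp x"] by (simp add: norm_mult abs_mult)
  have diff: "integral_bdd_on ?g S (M + N)"
    if "integral_bdd_on (?p (- l)) S M" "integral_bdd_on (?p l) S N" for S M N
    unfolding eq using that by (intro integral_bdd_on_diff continuous_on_cis_phase)
  have zero: "integral_bdd_on ?g S M" if "l = 0" "0 \<le> M" for S M
    using that unfolding integral_bdd_on_def by simp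
  show ?thesis
  proof (rule pv_integral_bound[OF _ cg])
    show "continuous_on (- {0}) (even_phase_integrand \<epsilon> l)"
      unfolding even_phase_integrand_def by (intro continuous_intros) auto
    show "exp x *\<^sub>R (even_phase_integrand \<epsilon> l (exp x) + even_phase_integrand \<epsilon> l (- exp x)) = ?g x" for x
    proof -
      have 1: "even_phase_integrand \<epsilon> l (exp x) = ?p (- l) x / of_real (exp x)"
        by (simp add: even_phase_integrand_def phase_def cis_conv_exp powr_def algebra_simps flip: exp_add)
      have 2: "even_phase_integrand \<epsilon> l (- exp x) = - ?p l x / of_real (exp x)"
        by (simp add: even_phase_integrand_def phase_def cis_conv_exp powr_def algebra_simps flip: exp_add)
      show ?thesis unfolding eq 1 2
        by (simp add: scaleR_conv_of_real field_simps flip: of_real_exp)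
    qed
    show "integral_bdd_on ?g UNIV 74"
    proof (cases "l = 0")
      case False
      \<comment> \<open>The cut at \<open>- ln \<bar>l\<bar>\<close> makes this bound exactly 2,
        independent of \<open>l\<close>; hence \<open>74 = 2 + 36 + 36\<close>.\<close>
      have l: "integral_bdd_on ?g {..- ln \<bar>l\<bar>} (2 * \<bar>l\<bar> / 1 * exp (1 * - ln \<bar>l\<bar>))"
        using left by (intro integral_bdd_on_exp cg) auto
      have r: "integral_bdd_on ?g {- ln \<bar>l\<bar>..} (36 + 36)"
        using integral_cis_even_phase_bdd[OF e, of "- l"] integral_cis_even_phase_bdd[OF e, of l] False
        by (intro diff) auto
      have "integral_bdd_on ?g UNIV (2 * \<bar>l\<bar> / 1 * exp (1 * - ln \<bar>l\<bar>) + (36 + 36))"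
        by (rule integral_bdd_on_split[OF cg, where S = UNIV, unfolded Int_UNIV_left, OF l r])
      then show ?thesis using False by (simp add: exp_minus mult.assoc)
    next
      case True
      then show ?thesis by (rule zero) simp
    qed
    show "\<exists>N. integral_bdd_on ?g {..N} d" if "0 < d" for d
      using left that by (intro integral_exp_tail_bot[OF cg, where k = 1 and K = "2 * \<bar>l\<bar>"]) auto
    show "\<exists>N. integral_bdd_on ?g {N..} d" if d: "0 < d" for d
    proof (cases "l = 0")
      case False
      have lim: "filterlim (\<lambda>x. \<bar>phase k (1 * \<epsilon>) \<epsilon> x\<bar>) at_top at_top" if "k \<noteq> 0" for k
        using e that by (intro phase_at_top_lt_1) auto
      obtain N1 where N1: "integral_bdd_on (?p (- l)) {N1..} (d / 2)"
        using integral_cis_phase_tail[OF lim, of "- l" "d / 2"] False d by auto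
      obtain N2 where N2: "integral_bdd_on (?p l) {N2..} (d / 2)"
        using integral_cis_phase_tail[OF lim, of l "d / 2"] False d by auto
      have "integral_bdd_on ?g {max N1 N2..} (d / 2 + d / 2)"
        by (intro diff integral_bdd_on_mono[OF N1] integral_bdd_on_mono[OF N2]) auto
      then show ?thesis by auto
    next
      case True
      then show ?thesis using zero[OF _ less_imp_le[OF d]] by blast
    qed
  qed
qed

theorem theorem1p6:
  shows "\<exists>C0::real. C0 > 0 \<and>
    (\<forall>\<epsilon>1::real. \<bar>\<epsilon>1\<bar> < 1/2 \<longrightarrow>
       (\<forall>l::real. pv_convergent (even_phase_integrand \<epsilon>1 l)) \<and>
       (SUP l::real. ereal (cmod (pv_integral (even_phase_integrand \<epsilon>1 l)))) \<le> ereal C0) \<and>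
    (\<forall>\<epsilon>2::real. 1/2 < \<epsilon>2 \<and> \<epsilon>2 < 3/2 \<longrightarrow>
       (\<forall>l::real. pv_convergent (odd_phase_integrand \<epsilon>2 l)) \<and>
       (SUP l::real. ereal (cmod (pv_integral (odd_phase_integrand \<epsilon>2 l)))) \<le> ereal C0)"
\<comment> \<open>The odd bound \<open>436 = 2 * 218\<close> also exceeds the even bound 74.\<close>
proof (intro exI[of _ "436::real"] conjI allI impI SUP_least)
  show "ereal (cmod (pv_integral (even_phase_integrand \<epsilon> l))) \<le> ereal 436" if "\<bar>\<epsilon>\<bar> < 1/2" for \<epsilon> l
    using pv_even_phase[OF that, of l] by simp
qed (use pv_even_phase pv_odd_phase in auto)

end
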